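(* Let $V_0,V_1,W_0,W_1$ be polarized super Hilbert spaces and let $L\subset\Pi V_0\oplus V_1$ be a split Lagrangian. Let moreover $S\colon V_0\to W_0$ and $T\colon V_1\to W_1$ be isomorphisms of polarized super Hilbert spaces. Then the composition $$\mathrm{graph}(T)\circ L\circ\mathrm{graph}(S^* )\subset\Pi W_0\oplus W_1$$ is a split Lagrangian.
   Context: A super Hilbert space is a (real or complex) Hilbert space $V$ with an orthogonal decomposition $V=V^+\oplus V^-$; its grading operator $\Gamma$ is $\pm1$ on $V^\pm$, and $B(x,y)=\langle\Gamma x,y\rangle$. A subspace $L$ is $B$-isotropic if $B$ vanishes on $L\times L$. A sub-Lagrangian is a closed $B$-isotropic subspace $L$ such that $L+\Gamma L$ has finite codimension in $V$; a Lagrangian is a $B$-isotropic subspace with $L+\Gamma L=V$. $\Pi V$ is the same Hilbert space with grading operator $-\Gamma$. Two closed subspaces of a Hilbert space are close if the difference of their orthogonal projections is Hilbert--Schmidt; this is an equivalence relation. A polarized super Hilbert space is a super Hilbert space $V$ with a distinguished closeness class $[L]$ of sub-Lagrangians. An isomorphism between polarized super Hilbert spaces $(V_0,[L_0])$ and $(V_1,[L_1])$ is a grading-preserving unitary $T\colon V_0\to V_1$ with $TL_0\in[L_1]$ for some (hence all) sub-Lagrangians $L_0$ representing the polarization of $V_0$. If $V_0,V_1$ are polarized by $[L_0],[L_1]$, a Lagrangian $L\subset\Pi V_0\oplus V_1$ is split if it is close to $L_0^\perp\oplus L_1$ for some (hence any) sub-Lagrangians $L_i$ representing the polarization of $V_i$.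 For an operator $A\colon V\to W$, $\mathrm{graph}(A)=\{(x,Ax)\mid x\in V\}\subset V\oplus W$, and the composition of relations $R_{01}\subset V_0\oplus V_1$, $R_{12}\subset V_1\oplus V_2$ is $R_{12}\circ R_{01}=\{(x_0,x_2)\mid\exists x_1\in V_1:(x_0,x_1)\in R_{01},(x_1,x_2)\in R_{12}\}$. *)

theory Defs
  imports "HOL-Analysis.Analysis" "HOL-Library.Set_Algebras"
begin

text \<open>The scalars are an arbitrary field of the following class, so that real and complex Hilbert
  spaces are covered together. Each element \<open>x\<close> is a root of the real polynomial
  \<open>X\<^sup>2 - (x + conjugation x) X + (norm x)\<^sup>2\<close>, so the class has only the models \<open>\<real>\<close> and \<open>\<complex>\<close>,
  and the second axiom determines the conjugation.\<close>

class real_or_complex = real_normed_field +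
  fixes conjugation :: "'a \<Rightarrow> 'a"
  assumes conjugation_add: "conjugation (x + y) = conjugation x + conjugation y"
    and mult_conjugation: "x * conjugation x = (norm x)\<^sup>2 *\<^sub>R 1"

instantiation real :: real_or_complex
begin
definition conjugation_real :: "real \<Rightarrow> real" where "conjugation_real x = x"
instance by standard (simp_all add: conjugation_real_def power2_eq_square)
end

instantiation complex :: real_or_complex
begin
definition conjugation_complex :: "complex \<Rightarrow> complex" where "conjugation_complex = cnj"
instance by standard (simp_all add: conjugation_complex_def complex_norm_square scaleR_conv_of_real del: of_real_power)
end


section \<open>Super Hilbert spaces\<close>

text \<open>The underlying set of a Hilbert space is a whole type; completeness comes from the class
  \<open>banach\<close>, whose norm and real scalar multiplication are tied to the Hilbert space structure
  by \<open>hilbert_space\<close>.\<close>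

record ('k, 'v) super_hilbert =
  scale :: "'k \<Rightarrow> 'v \<Rightarrow> 'v"
  iprod :: "'v \<Rightarrow> 'v \<Rightarrow> 'k"
  grading :: "'v \<Rightarrow> 'v"

definition hilbert_space :: "('k::real_or_complex, 'v::banach, 'z) super_hilbert_scheme \<Rightarrow> bool" where
  "hilbert_space V \<longleftrightarrow>
     vector_space (scale V) \<and>
     (\<forall>r x. scale V (of_real r) x = r *\<^sub>R x) \<and>
     (\<forall>x y z. iprod V (x + y) z = iprod V x z + iprod V y z) \<and>
     (\<forall>c x y. iprod V (scale V c x) y = c * iprod V x y) \<and>
     (\<forall>x y. iprod V y x = conjugation (iprod V x y)) \<and>
     (\<forall>x. iprod V x x = of_real ((norm x)\<^sup>2))"

definition even_part :: "('k, 'v, 'z) super_hilbert_scheme \<Rightarrow> 'v set" where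
  "even_part V = {x. grading V x = x}"

definition odd_part :: "('k, 'v::ab_group_add, 'z) super_hilbert_scheme \<Rightarrow> 'v set" where
  "odd_part V = {x. grading V x = - x}"

definition super_hilbert_space ::
    "('k::real_or_complex, 'v::banach, 'z) super_hilbert_scheme \<Rightarrow> bool" where
  "super_hilbert_space V \<longleftrightarrow>
     hilbert_space V \<and>
     Vector_Spaces.linear (scale V) (scale V) (grading V) \<and>
     (\<forall>x\<in>even_part V. \<forall>y\<in>odd_part V. iprod V x y = 0) \<and>
     even_part V + odd_part V = UNIV"

definition parity_shift ::
    "('k, 'v::ab_group_add, 'z) super_hilbert_scheme \<Rightarrow> ('k, 'v) super_hilbert" where
  "parity_shift V = \<lparr>scale = scale V, iprod = iprod V, grading = (\<lambda>x. - grading V x)\<rparr>"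

definition direct_sum ::
    "('k::plus, 'v, 'y) super_hilbert_scheme \<Rightarrow> ('k, 'w, 'z) super_hilbert_scheme
      \<Rightarrow> ('k, 'v \<times> 'w) super_hilbert" where
  "direct_sum V W =
     \<lparr>scale = (\<lambda>c (x, y). (scale V c x, scale W c y)),
      iprod = (\<lambda>(x, y) (x', y'). iprod V x x' + iprod W y y'),
      grading = (\<lambda>(x, y). (grading V x, grading W y))\<rparr>"


section \<open>Closeness of subspaces\<close>

definition closed_subspace ::
    "('k::real_or_complex, 'v::banach, 'z) super_hilbert_scheme \<Rightarrow> 'v set \<Rightarrow> bool" where
  "closed_subspace V L \<longleftrightarrow> module.subspace (scale V) L \<and> closed L"

definition orth :: "('k::zero, 'v, 'z) super_hilbert_scheme \<Rightarrow> 'v set \<Rightarrow> 'v set" where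
  "orth V L = {x. \<forall>y\<in>L. iprod V x y = 0}"

definition orth_proj ::
    "('k::zero, 'v::ab_group_add, 'z) super_hilbert_scheme \<Rightarrow> 'v set \<Rightarrow> 'v \<Rightarrow> 'v" where
  "orth_proj V L x = (THE p. p \<in> L \<and> x - p \<in> orth V L)"

definition orthonormal_basis ::
    "('k::real_or_complex, 'v::banach, 'z) super_hilbert_scheme \<Rightarrow> 'v set \<Rightarrow> bool" where
  "orthonormal_basis V E \<longleftrightarrow>
     (\<forall>x\<in>E. \<forall>y\<in>E. iprod V x y = (if x = y then 1 else 0)) \<and>
     closure (module.span (scale V) E) = UNIV"

definition hilbert_schmidt ::
    "('k::real_or_complex, 'v::banach, 'z) super_hilbert_scheme \<Rightarrow> ('v \<Rightarrow> 'v) \<Rightarrow> bool" where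
  "hilbert_schmidt V A \<longleftrightarrow>
     Vector_Spaces.linear (scale V) (scale V) A \<and> bounded_linear A \<and>
     (\<forall>E. orthonormal_basis V E \<longrightarrow> (\<lambda>e. (norm (A e))\<^sup>2) summable_on E)"

definition close ::
    "('k::real_or_complex, 'v::banach, 'z) super_hilbert_scheme \<Rightarrow> 'v set \<Rightarrow> 'v set \<Rightarrow> bool" where
  "close V L M \<longleftrightarrow>
     closed_subspace V L \<and> closed_subspace V M \<and>
     hilbert_schmidt V (\<lambda>x. orth_proj V L x - orth_proj V M x)"


section \<open>Lagrangians and polarizations\<close>

definition isotropic ::
    "('k::real_or_complex, 'v::banach, 'z) super_hilbert_scheme \<Rightarrow> 'v set \<Rightarrow> bool" where
  "isotropic V L \<longleftrightarrow>
     module.subspace (scale V) L \<and> (\<forall>x\<in>L. \<forall>y\<in>L. iprod V (grading V x) y = 0)"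

definition sub_lagrangian ::
    "('k::real_or_complex, 'v::banach, 'z) super_hilbert_scheme \<Rightarrow> 'v set \<Rightarrow> bool" where
  "sub_lagrangian V L \<longleftrightarrow>
     closed L \<and> isotropic V L \<and>
     (\<exists>F. finite F \<and> module.span (scale V) ((L + grading V ` L) \<union> F) = UNIV)"

definition lagrangian ::
    "('k::real_or_complex, 'v::banach, 'z) super_hilbert_scheme \<Rightarrow> 'v set \<Rightarrow> bool" where
  "lagrangian V L \<longleftrightarrow> isotropic V L \<and> L + grading V ` L = UNIV"

record ('k, 'v) polarized = "('k, 'v) super_hilbert" +
  polarization :: "'v set set"

definition polarized_super_hilbert_space :: "('k::real_or_complex, 'v::banach) polarized \<Rightarrow> bool" where
  "polarized_super_hilbert_space V \<longleftrightarrow>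
     super_hilbert_space V \<and>
     (\<exists>L. sub_lagrangian V L \<and> polarization V = {M. sub_lagrangian V M \<and> close V L M})"

definition unitary_map ::
    "('k::real_or_complex, 'v::banach, 'y) super_hilbert_scheme
      \<Rightarrow> ('k, 'w::banach, 'z) super_hilbert_scheme \<Rightarrow> ('v \<Rightarrow> 'w) \<Rightarrow> bool" where
  "unitary_map V W T \<longleftrightarrow>
     Vector_Spaces.linear (scale V) (scale W) T \<and> bij T \<and>
     (\<forall>x y. iprod W (T x) (T y) = iprod V x y)"

definition polarized_isomorphism ::
    "('k::real_or_complex, 'v::banach) polarized \<Rightarrow> ('k, 'w::banach) polarized
      \<Rightarrow> ('v \<Rightarrow> 'w) \<Rightarrow> bool" where
  "polarized_isomorphism V W T \<longleftrightarrow>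
     unitary_map V W T \<and> (\<forall>x. T (grading V x) = grading W (T x)) \<and>
     (\<exists>L\<in>polarization V. T ` L \<in> polarization W)"

definition split_lagrangian ::
    "('k::real_or_complex, 'v::banach) polarized \<Rightarrow> ('k, 'w::banach) polarized
      \<Rightarrow> ('v \<times> 'w) set \<Rightarrow> bool" where
  "split_lagrangian V W L \<longleftrightarrow>
     lagrangian (direct_sum (parity_shift V) W) L \<and>
     (\<exists>M\<in>polarization V. \<exists>N\<in>polarization W.
        close (direct_sum (parity_shift V) W) L (orth V M \<times> N))"


section \<open>Linear relations\<close>

definition hilbert_adjoint ::
    "('k, 'v, 'y) super_hilbert_scheme \<Rightarrow> ('k, 'w, 'z) super_hilbert_scheme
      \<Rightarrow> ('v \<Rightarrow> 'w) \<Rightarrow> 'w \<Rightarrow> 'v" where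
  "hilbert_adjoint V W A = (SOME A'. \<forall>x y. iprod W (A x) y = iprod V x (A' y))"

definition op_graph :: "('v \<Rightarrow> 'w) \<Rightarrow> ('v \<times> 'w) set" where
  "op_graph A = {(x, A x) | x. True}"

text \<open>Relations are composed in the usual order of maps, while the library's \<open>O\<close> takes the relation
  applied first as its left argument.\<close>

definition rel_compose :: "('b \<times> 'c) set \<Rightarrow> ('a \<times> 'b) set \<Rightarrow> ('a \<times> 'c) set"
    (infixr "\<circ>\<^sub>R" 75) where
  "R12 \<circ>\<^sub>R R01 = R01 O R12"

end

theory Submission
  imports Defs
begin

text \<open>Since \<open>S\<close> is unitary, \<open>S\<^sup>* = S\<^sup>-\<^sup>1\<close>, so the composition is the image of \<open>L\<close> under the
  grading-preserving unitary \<open>S \<oplus> T\<close>. Unitaries conjugate orthogonal projections, hence preserve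
  Lagrangians and closeness; and \<open>S\<close>, \<open>T\<close> map every representative of the
  polarizations to a representative because closeness is an equivalence relation.\<close>

section \<open>Orthogonal projections\<close>

lemma conjugation_zero: "conjugation (0::'k::real_or_complex) = 0"
  using conjugation_add[of "0::'k" 0] by simp

lemma conjugation_diff: "conjugation (x - y) = conjugation x - conjugation (y::'k::real_or_complex)"
  using conjugation_add[of "x - y" y] by simp

section \<open>Inner product identities and projection onto a closed subspace\<close>

context
  fixes V :: "('k::real_or_complex, 'v::banach, 'z) super_hilbert_scheme"
  assumes V: "hilbert_space V"
begin

lemma vector_space_scale: "vector_space (scale V)"
  using V unfolding hilbert_space_def by blast

lemma module_scale: "module (scale V)"
  using vector_space_scale module_iff_vector_space by blast

lemma scale_of_real: "scale V (of_real r) x = r *\<^sub>R x"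
  using V unfolding hilbert_space_def by blast

lemma iprod_add_left: "iprod V (x + y) z = iprod V x z + iprod V y z"
  using V unfolding hilbert_space_def by blast

lemma iprod_scale_left: "iprod V (scale V c x) y = c * iprod V x y"
  using V unfolding hilbert_space_def by blast

lemma iprod_commute: "iprod V y x = conjugation (iprod V x y)"
  using V unfolding hilbert_space_def by blast

lemma iprod_self: "iprod V x x = of_real ((norm x)\<^sup>2)"
  using V unfolding hilbert_space_def by blast

lemma iprod_diff_left: "iprod V (x - y) z = iprod V x z - iprod V y z"
  using iprod_add_left[of "x - y" y z] by simp

lemma iprod_add_right: "iprod V z (x + y) = iprod V z x + iprod V z y"
  using iprod_commute iprod_add_left conjugation_add by metis

lemma iprod_diff_right: "iprod V z (x - y) = iprod V z x - iprod V z y"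
  using iprod_commute iprod_diff_left conjugation_diff by metis

lemma iprod_eq_0_commute: "iprod V x y = 0 \<longleftrightarrow> iprod V y x = 0"
  using iprod_commute conjugation_zero by metis

lemma iprod_self_eq_0: "iprod V x x = 0 \<longleftrightarrow> x = 0"
  by (simp add: iprod_self)

lemma pythagoras:
  assumes "iprod V x y = 0"
  shows "(norm (x + y))\<^sup>2 = (norm x)\<^sup>2 + (norm y)\<^sup>2"
proof -
  have "iprod V (x + y) (x + y) = iprod V x x + iprod V y y"
    using assms iprod_eq_0_commute[of x y] by (simp add: iprod_add_left iprod_add_right)
  \<comment> \<open>The inner product is valued in \<open>'k\<close>, so the real identity is proved
    inside \<open>'k\<close> and pulled back along the injective \<open>of_real\<close>.\<close>
  then have "(of_real ((norm (x + y))\<^sup>2) :: 'k) = of_real ((norm x)\<^sup>2 + (norm y)\<^sup>2)"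
    by (simp only: iprod_self of_real_add)
  then show ?thesis by (simp only: of_real_eq_iff)
qed

lemma parallelogram_law:
  fixes x y :: 'v
  shows "(norm (x + y))\<^sup>2 + (norm (x - y))\<^sup>2 = 2 * (norm x)\<^sup>2 + 2 * (norm y)\<^sup>2"
proof -
  have "iprod V (x + y) (x + y) + iprod V (x - y) (x - y)
      = iprod V x x + iprod V x x + iprod V y y + iprod V y y"
    by (simp add: iprod_add_left iprod_add_right iprod_diff_left iprod_diff_right)
  then have "(of_real ((norm (x + y))\<^sup>2 + (norm (x - y))\<^sup>2) :: 'k)
      = of_real ((norm x)\<^sup>2 + (norm x)\<^sup>2 + (norm y)\<^sup>2 + (norm y)\<^sup>2)"
    by (simp only: iprod_self of_real_add)
  then show ?thesis by (simp only: of_real_eq_iff)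
qed

text \<open>The parallelogram law makes a distance-minimizing sequence in \<open>L\<close> Cauchy;
  completeness gives a limit, closedness puts it in \<open>L\<close>.\<close>

lemma closed_subspace_minimizer:
  assumes L: "closed_subspace V L"
  obtains p where "p \<in> L" "\<And>q. q \<in> L \<Longrightarrow> norm (x - p) \<le> norm (x - q)"
proof -
  have sub: "module.subspace (scale V) L" and cl: "closed L"
    using L by (auto simp: closed_subspace_def)
  have ne: "L \<noteq> {}" using module.subspace_0[OF module_scale sub] by auto
  define D where "D = (INF p\<in>L. (norm (x - p))\<^sup>2)"
  have D_le: "D \<le> (norm (x - p))\<^sup>2" if "p \<in> L" for p
    unfolding D_def by (rule cINF_lower[OF _ that]) (auto intro!: bdd_belowI[of _ 0])
  have "\<exists>p\<in>L. (norm (x - p))\<^sup>2 < D + 1 / real (Suc n)" for n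
  proof (rule ccontr)
    assume "\<not> ?thesis"
    then have "D + 1 / real (Suc n) \<le> D"
      unfolding D_def by (intro cINF_greatest[OF ne]) (auto simp: D_def not_less)
    then show False by simp
  qed
  then obtain p where pL: "\<And>n. p n \<in> L" and p: "\<And>n. (norm (x - p n))\<^sup>2 < D + 1 / real (Suc n)"
    by metis
  \<comment> \<open>The midpoint of \<open>p m\<close> and \<open>p n\<close> lies in
    \<open>L\<close>, so its squared distance to \<open>x\<close> is at least \<open>D\<close>. In
    the parallelogram law this cancels the two contributions \<open>2 * D\<close> and leaves only
    the error terms.\<close>
  have dist2: "(norm (p m - p n))\<^sup>2 < 2 / real (Suc m) + 2 / real (Suc n)" for m n
  proof -
    let ?q = "(1 / 2 :: real) *\<^sub>R (p m + p n)"
    have "?q \<in> L"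
      using module.subspace_scale[OF module_scale sub module.subspace_add[OF module_scale sub pL pL]]
      by (metis scale_of_real)
    then have "D \<le> (norm (x - ?q))\<^sup>2" by (rule D_le)
    moreover have "(x - p m) + (x - p n) = 2 *\<^sub>R (x - ?q)"
      by (simp add: algebra_simps scaleR_2)
    then have "(norm ((x - p m) + (x - p n)))\<^sup>2 = 4 * (norm (x - ?q))\<^sup>2"
      by (simp add: power_mult_distrib)
    moreover have "(x - p m) - (x - p n) = - (p m - p n)" by simp
    then have "norm ((x - p m) - (x - p n)) = norm (p m - p n)" by (simp only: norm_minus_cancel)
    ultimately show ?thesis
      using parallelogram_law[of "x - p m" "x - p n"] p[of m] p[of n] by simp
  qed
  have "Cauchy p"
  proof (rule CauchyI)
    fix e :: real assume e: "0 < e"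
    \<comment> \<open>The constant 4 makes each of the two error terms in \<open>dist2\<close>
      smaller than half of the square of \<open>e\<close>.\<close>
    obtain N where N: "4 / e\<^sup>2 < real (Suc N)"
      using reals_Archimedean2[of "4 / e\<^sup>2"] by (metis less_Suc_eq less_trans of_nat_less_iff)
    have "norm (p m - p n) < e" if "m \<ge> N" "n \<ge> N" for m n
    proof -
      have "2 / real (Suc k) < e\<^sup>2 / 2" if "k \<ge> N" for k
      proof -
        have "4 / e\<^sup>2 < real (Suc k)" using N that by simp
        then show ?thesis using e by (simp add: field_simps)
      qed
      then have "(norm (p m - p n))\<^sup>2 < e\<^sup>2" using dist2[of m n] that
        by (smt (verit) field_sum_of_halves)
      then show ?thesis using e by (simp add: power2_less_imp_less)
    qed
    then show "\<exists>M. \<forall>m\<ge>M. \<forall>n\<ge>M. norm (p m - p n) < e" by blast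
  qed
  then obtain q where q: "p \<longlonglongrightarrow> q" by (auto simp: Cauchy_convergent_iff convergent_def)
  have "q \<in> L" using closed_sequentially[OF cl _ q] pL by blast
  moreover have "norm (x - q) \<le> norm (x - r)" if "r \<in> L" for r
  proof -
    have "(\<lambda>n. (norm (x - p n))\<^sup>2) \<longlonglongrightarrow> (norm (x - q))\<^sup>2"
      by (intro tendsto_intros q)
    moreover have "(\<lambda>n. D + 1 / real (Suc n)) \<longlonglongrightarrow> D + 0"
      by (intro tendsto_intros LIMSEQ_Suc[OF lim_1_over_n])
    ultimately have "(norm (x - q))\<^sup>2 \<le> D + 0"
      by (rule LIMSEQ_le) (use p in \<open>auto intro: less_imp_le\<close>)
    then have "(norm (x - q))\<^sup>2 \<le> (norm (x - r))\<^sup>2" using D_le[OF that] by linarith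
    then show ?thesis by (rule power2_le_imp_le) simp
  qed
  ultimately show thesis using that by blast
qed

lemma orth_proj_exists:
  assumes L: "closed_subspace V L"
  shows "\<exists>p\<in>L. x - p \<in> orth V L"
proof -
  have sub: "module.subspace (scale V) L" using L by (simp add: closed_subspace_def)
  obtain p where pL: "p \<in> L" and min: "\<And>q. q \<in> L \<Longrightarrow> norm (x - p) \<le> norm (x - q)"
    using closed_subspace_minimizer[OF L] by blast
  have "iprod V (x - p) y = 0" if y: "y \<in> L" for y
  proof (cases "y = 0")
    case True
    then show ?thesis using iprod_diff_right[of "x - p" 0 0] by simp
  next
    case False
    \<comment> \<open>\<open>z\<close> is the projection of \<open>x - p\<close> to the line through \<open>y\<close>: replacing \<open>p\<close> by \<open>p + z\<close> would
      decrease the distance to \<open>x\<close> unless \<open>z = 0\<close>.\<close>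
    define z where "z = scale V (iprod V (x - p) y / iprod V y y) y"
    have zL: "z \<in> L" unfolding z_def by (rule module.subspace_scale[OF module_scale sub y])
    have zy: "iprod V z y = iprod V (x - p) y"
      using False by (simp add: z_def iprod_scale_left iprod_self_eq_0)
    then have "iprod V y (x - p - z) = 0"
      using iprod_eq_0_commute[of "x - p - z" y] by (simp add: iprod_diff_left)
    then have "iprod V z (x - p - z) = 0" by (simp add: z_def iprod_scale_left)
    then have "(norm (z + (x - p - z)))\<^sup>2 = (norm z)\<^sup>2 + (norm (x - p - z))\<^sup>2"
      by (rule pythagoras)
    then have "(norm (x - p))\<^sup>2 = (norm z)\<^sup>2 + (norm (x - (p + z)))\<^sup>2" by (simp add: algebra_simps)
    moreover have "norm (x - p) \<le> norm (x - (p + z))"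
      by (intro min module.subspace_add[OF module_scale sub pL zL])
    then have "(norm (x - p))\<^sup>2 \<le> (norm (x - (p + z)))\<^sup>2" by (simp add: power_mono)
    ultimately have "z = 0" by simp
    then show ?thesis using zy iprod_diff_left[of 0 0 y] by simp
  qed
  then show ?thesis using pL by (auto simp: orth_def)
qed

text \<open>The vector \<open>p - q\<close> lies in \<open>L\<close> and is also a difference of two
  vectors orthogonal to \<open>L\<close>, hence orthogonal to itself.\<close>

lemma orth_proj_unique:
  assumes sub: "module.subspace (scale V) L"
    and p: "p \<in> L" "x - p \<in> orth V L" and q: "q \<in> L" "x - q \<in> orth V L"
  shows "p = q"
proof -
  have "p - q \<in> L" by (rule module.subspace_diff[OF module_scale sub p(1) q(1)])
  then have "iprod V (x - q) (p - q) - iprod V (x - p) (p - q) = 0"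
    using p(2) q(2) by (simp add: orth_def)
  then have "iprod V (p - q) (p - q) = 0" by (simp add: iprod_diff_left)
  then show ?thesis by (simp add: iprod_self_eq_0)
qed

text \<open>Resolves the definite description: \<open>p\<close> itself witnesses existence, and
  uniqueness is the previous lemma.\<close>

lemma orth_proj_eqI:
  assumes "module.subspace (scale V) L" "p \<in> L" "x - p \<in> orth V L"
  shows "orth_proj V L x = p"
  unfolding orth_proj_def using assms orth_proj_unique by blast

end

section \<open>Closeness\<close>

text \<open>Summability follows by comparison, since the square of \<open>a + b\<close> is at most
  twice the sum of the squares of \<open>a\<close> and \<open>b\<close>. This is what makes
  closeness transitive.\<close>

lemma hilbert_schmidt_add:
  fixes V :: "('k::real_or_complex, 'v::banach, 'z) super_hilbert_scheme"
  assumes A: "hilbert_schmidt V A" and B: "hilbert_schmidt V B"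
  shows "hilbert_schmidt V (\<lambda>x. A x + B x)"
  unfolding hilbert_schmidt_def
proof (intro conjI allI impI)
  have lin: "module_hom (scale V) (scale V) A" "module_hom (scale V) (scale V) B"
    using A B by (auto simp: hilbert_schmidt_def module_hom_iff_linear)
  have vs: "vector_space (scale V)"
    using A by (auto simp: hilbert_schmidt_def Vector_Spaces.linear_iff)
  show "Vector_Spaces.linear (scale V) (scale V) (\<lambda>x. A x + B x)"
    unfolding Vector_Spaces.linear_iff
    using vs module_hom.add[OF lin(1)] module_hom.add[OF lin(2)] module_hom.scale[OF lin(1)]
      module_hom.scale[OF lin(2)] vector_space.vector_space_assms(1)[OF vs]
    by (simp add: algebra_simps)
  show "bounded_linear (\<lambda>x. A x + B x)"
    using A B by (intro bounded_linear_add) (auto simp: hilbert_schmidt_def)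
  fix E assume E: "orthonormal_basis V E"
  have "(\<lambda>e. 2 * (norm (A e))\<^sup>2 + 2 * (norm (B e))\<^sup>2) summable_on E"
    using A B E by (intro summable_on_add summable_on_cmult_right) (auto simp: hilbert_schmidt_def)
  then show "(\<lambda>e. (norm (A e + B e))\<^sup>2) summable_on E"
  proof (rule summable_on_comparison_test)
    fix e
    have "(norm (A e + B e))\<^sup>2 \<le> (norm (A e) + norm (B e))\<^sup>2"
      by (intro power_mono norm_triangle_ineq norm_ge_zero)
    also have "\<dots> \<le> 2 * (norm (A e))\<^sup>2 + 2 * (norm (B e))\<^sup>2"
      using sum_squares_bound[of "norm (A e)" "norm (B e)"] by (simp add: power2_sum)
    finally show "(norm (A e + B e))\<^sup>2 \<le> 2 * (norm (A e))\<^sup>2 + 2 * (norm (B e))\<^sup>2" .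
  qed auto
qed

lemma hilbert_schmidt_minus:
  fixes V :: "('k::real_or_complex, 'v::banach, 'z) super_hilbert_scheme"
  assumes A: "hilbert_schmidt V A"
  shows "hilbert_schmidt V (\<lambda>x. - A x)"
proof -
  have lin: "module_hom (scale V) (scale V) A"
    using A by (auto simp: hilbert_schmidt_def module_hom_iff_linear)
  have vs: "vector_space (scale V)"
    using A by (auto simp: hilbert_schmidt_def Vector_Spaces.linear_iff)
  then have "Vector_Spaces.linear (scale V) (scale V) (\<lambda>x. - A x)"
    using module_hom.add[OF lin] module_hom.scale[OF lin]
      module.scale_minus_right[OF module_hom.axioms(1)[OF lin]]
    by (simp add: Vector_Spaces.linear_iff)
  then show ?thesis
    using A by (auto simp: hilbert_schmidt_def intro: bounded_linear_minus)
qed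

lemma close_sym: "close V L M \<Longrightarrow> close V M L"
  using hilbert_schmidt_minus by (fastforce simp: close_def)

text \<open>The difference of the projections to \<open>L\<close> and \<open>N\<close> telescopes
  through the projection to \<open>M\<close>.\<close>

lemma close_trans: "close V L M \<Longrightarrow> close V M N \<Longrightarrow> close V L N"
  using hilbert_schmidt_add by (fastforce simp: close_def)

section \<open>Unitary invariance\<close>

text \<open>Lets every later fact about unitaries be applied to \<open>inv U\<close> as well, which
  is how continuity and orthonormal bases are pulled back from \<open>W\<close>.\<close>

lemma unitary_map_inv:
  assumes "unitary_map V W U"
  shows "unitary_map W V (inv U)"
proof -
  have b: "bij U" and lin: "Vector_Spaces.linear (scale V) (scale W) U"
    and ip: "\<And>x y. iprod W (U x) (U y) = iprod V x y"
    using assms by (auto simp: unitary_map_def)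
  have mh: "module_hom (scale V) (scale W) U" by (rule module_hom_linearI[OF lin])
  have UI: "U (inv U y) = y" for y using b by (simp add: bij_is_surj surj_f_inv_f)
  have IU: "inv U (U y) = y" for y using b by (simp add: bij_is_inj)
  have "inv U (a + b) = inv U a + inv U b" for a b
    using module_hom.add[OF mh, of "inv U a" "inv U b"] UI IU by metis
  moreover have "inv U (scale W c a) = scale V c (inv U a)" for a c
    using module_hom.scale[OF mh, of c "inv U a"] UI IU by metis
  ultimately show ?thesis
    using lin ip UI b unfolding unitary_map_def Vector_Spaces.linear_iff
    by (metis bij_imp_bij_inv)
qed

section \<open>Algebraic consequences of unitarity\<close>

context
  fixes V :: "('k::real_or_complex, 'v::banach, 'y) super_hilbert_scheme"
    and W :: "('k, 'w::banach, 'z) super_hilbert_scheme"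
    and U :: "'v \<Rightarrow> 'w"
  assumes U: "unitary_map V W U"
begin

lemma unitary_module_hom: "module_hom (scale V) (scale W) U"
  using U by (simp add: unitary_map_def module_hom_iff_linear)

lemma unitary_bij: "bij U"
  using U by (simp add: unitary_map_def)

lemma unitary_iprod: "iprod W (U x) (U y) = iprod V x y"
  using U by (simp add: unitary_map_def)

lemma unitary_surj: "U (inv U y) = y"
  using unitary_bij by (simp add: bij_is_surj surj_f_inv_f)

lemma unitary_orth: "orth W (U ` L) = U ` orth V L"
proof -
  have "y \<in> U ` orth V L" if "y \<in> orth W (U ` L)" for y
    using that unitary_iprod unitary_surj[of y]
    by (intro image_eqI[of _ _ "inv U y"]) (auto simp: orth_def, metis)
  then show ?thesis by (auto simp: orth_def unitary_iprod)
qed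

lemma unitary_subspace: "module.subspace (scale V) L \<Longrightarrow> module.subspace (scale W) (U ` L)"
  by (rule module_hom.subspace_image[OF unitary_module_hom])

end

section \<open>Norms, projections and adjoints under a unitary\<close>

context
  fixes V :: "('k::real_or_complex, 'v::banach, 'y) super_hilbert_scheme"
    and W :: "('k, 'w::banach, 'z) super_hilbert_scheme"
    and U :: "'v \<Rightarrow> 'w"
  assumes V: "hilbert_space V" and W: "hilbert_space W" and U: "unitary_map V W U"
begin

lemma unitary_norm: "norm (U x) = norm x"
proof -
  have "(of_real ((norm (U x))\<^sup>2) :: 'k) = of_real ((norm x)\<^sup>2)"
    using unitary_iprod[OF U, of x x] iprod_self[OF V] iprod_self[OF W] by metis
  then have "(norm (U x))\<^sup>2 = (norm x)\<^sup>2" by (simp only: of_real_eq_iff)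
  then show ?thesis by simp
qed

text \<open>Real scalars act through \<open>of_real\<close> in both spaces, so linearity over
  \<open>'k\<close> gives real linearity; the isometry property gives the bound 1.\<close>

lemma unitary_bounded_linear: "bounded_linear U"
  using module_hom.add[OF unitary_module_hom[OF U]] module_hom.scale[OF unitary_module_hom[OF U]]
    scale_of_real[OF V] scale_of_real[OF W] unitary_norm
  by (intro bounded_linear_intro[where K = 1]) (metis, metis, simp)

lemma unitary_orth_proj:
  assumes L: "closed_subspace V L"
  shows "orth_proj W (U ` L) (U x) = U (orth_proj V L x)"
proof -
  have sub: "module.subspace (scale V) L" using L by (simp add: closed_subspace_def)
  obtain p where p: "p \<in> L" "x - p \<in> orth V L" using orth_proj_exists[OF V L] by blast
  have "U x - U p \<in> orth W (U ` L)"
    using p(2) by (simp add: module_hom.diff[OF unitary_module_hom[OF U], symmetric] unitary_orth[OF U])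
  then have "orth_proj W (U ` L) (U x) = U p"
    using p(1) by (intro orth_proj_eqI[OF W] unitary_subspace[OF U] sub) auto
  then show ?thesis using orth_proj_eqI[OF V sub p] by simp
qed

text \<open>\<open>inv U\<close> satisfies the adjoint identity, so the choice in
  \<open>hilbert_adjoint\<close> also yields a map satisfying it. The values of both at
  \<open>y\<close> differ by a vector \<open>?d\<close> that is orthogonal to itself.\<close>

lemma hilbert_adjoint_unitary: "hilbert_adjoint V W U = inv U"
proof -
  have "\<exists>A'. \<forall>x y. iprod W (U x) y = iprod V x (A' y)"
    using unitary_iprod[OF U] unitary_surj[OF U] by metis
  then have adj: "\<forall>x y. iprod W (U x) y = iprod V x (hilbert_adjoint V W U y)"
    unfolding hilbert_adjoint_def by (rule someI_ex)
  show ?thesis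
  proof
    fix y
    let ?d = "hilbert_adjoint V W U y - inv U y"
    have "iprod V ?d ?d = iprod W (U ?d) y - iprod W (U ?d) (U (inv U y))"
      using adj unitary_iprod[OF U, of ?d "inv U y"] by (simp add: iprod_diff_right[OF V])
    then have "iprod V ?d ?d = 0" by (simp add: unitary_surj[OF U])
    then show "hilbert_adjoint V W U y = inv U y" by (simp add: iprod_self_eq_0[OF V])
  qed
qed

end

section \<open>Closed sets and orthonormal bases under a unitary\<close>

context
  fixes V :: "('k::real_or_complex, 'v::banach, 'y) super_hilbert_scheme"
    and W :: "('k, 'w::banach, 'z) super_hilbert_scheme"
    and U :: "'v \<Rightarrow> 'w"
  assumes V: "hilbert_space V" and W: "hilbert_space W" and U: "unitary_map V W U"
begin

lemmas inv_unitary = unitary_map_inv[OF U]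

text \<open>Turns an image under \<open>U\<close> into a preimage under the continuous map
  \<open>inv U\<close>, so that closedness is inherited.\<close>

lemma unitary_vimage: "inv U -` L = U ` L"
  using bij_vimage_eq_inv_image[OF unitary_bij[OF inv_unitary]] unitary_bij[OF U]
  by (simp add: inv_inv_eq)

lemma unitary_closed:
  assumes "closed L"
  shows "closed (U ` L)"
proof -
  have "continuous_on UNIV (inv U)"
    using unitary_bounded_linear[OF W V inv_unitary] by (simp add: linear_continuous_on)
  then have "closed (inv U -` L)" using assms continuous_on_closed_vimage[of UNIV "inv U"] by auto
  then show ?thesis by (simp add: unitary_vimage)
qed

lemma unitary_closed_subspace: "closed_subspace V L \<Longrightarrow> closed_subspace W (U ` L)"
  by (simp add: closed_subspace_def unitary_closed unitary_subspace[OF U])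

lemma unitary_orthonormal_basis:
  assumes E: "orthonormal_basis V E"
  shows "orthonormal_basis W (U ` E)"
  unfolding orthonormal_basis_def
proof (intro conjI)
  have inj: "U x = U y \<longleftrightarrow> x = y" for x y
    using unitary_bij[OF U] by (simp add: bij_is_inj inj_eq)
  show "\<forall>x\<in>U ` E. \<forall>y\<in>U ` E. iprod W x y = (if x = y then 1 else 0)"
    using E by (auto simp: orthonormal_basis_def unitary_iprod[OF U] inj)
  \<comment> \<open>Continuity suffices for density: the closure on the left is the whole space and
    \<open>U\<close> is onto.\<close>
  have "U ` closure (module.span (scale V) E) \<subseteq> closure (U ` module.span (scale V) E)"
    by (intro image_closure_subset closure_subset closed_closure linear_continuous_on
        unitary_bounded_linear[OF V W U])
  moreover have "range U = UNIV" using unitary_bij[OF U] by (simp add: bij_is_surj)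
  ultimately show "closure (module.span (scale W) (U ` E)) = UNIV"
    using E module_hom.span_image[OF unitary_module_hom[OF U], of E]
    by (auto simp: orthonormal_basis_def)
qed

end

section \<open>Closeness under a unitary\<close>

context
  fixes V :: "('k::real_or_complex, 'v::banach, 'y) super_hilbert_scheme"
    and W :: "('k, 'w::banach, 'z) super_hilbert_scheme"
    and U :: "'v \<Rightarrow> 'w"
  assumes V: "hilbert_space V" and W: "hilbert_space W" and U: "unitary_map V W U"
begin

lemma hilbert_schmidt_conjugate:
  assumes A: "hilbert_schmidt V A"
  shows "hilbert_schmidt W (\<lambda>y. U (A (inv U y)))"
  unfolding hilbert_schmidt_def
proof (intro conjI allI impI)
  note I = unitary_map_inv[OF U]
  have mh: "module_hom (scale V) (scale V) A"
    using A by (simp add: hilbert_schmidt_def module_hom_iff_linear)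
  show "Vector_Spaces.linear (scale W) (scale W) (\<lambda>y. U (A (inv U y)))"
    using module_hom_compose[OF unitary_module_hom[OF I] module_hom_compose[OF mh unitary_module_hom[OF U]]]
    by (simp only: module_hom_iff_linear o_def)
  show "bounded_linear (\<lambda>y. U (A (inv U y)))"
    using A
    by (intro bounded_linear_compose[OF unitary_bounded_linear[OF V W U]]
        bounded_linear_compose[OF _ unitary_bounded_linear[OF W V I]])
      (simp add: hilbert_schmidt_def)
  fix E assume "orthonormal_basis W E"
  then have "(\<lambda>e. (norm (A e))\<^sup>2) summable_on (inv U ` E)"
    using A unitary_orthonormal_basis[OF W V I] by (simp add: hilbert_schmidt_def)
  moreover have "inj_on (inv U) E"
    using unitary_bij[OF I] by (meson bij_is_inj inj_on_subset subset_UNIV)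
  ultimately show "(\<lambda>e. (norm (U (A (inv U e))))\<^sup>2) summable_on E"
    by (simp add: summable_on_reindex o_def unitary_norm[OF V W U])
qed

text \<open>The difference of the projections to \<open>U\<close> L\<open>and\<close>U
  \<open>M\<close> is the conjugate by \<open>U\<close> of the difference of the projections to
  \<open>L\<close> and \<open>M\<close>.\<close>

lemma unitary_close:
  assumes "close V L M"
  shows "close W (U ` L) (U ` M)"
proof -
  have L: "closed_subspace V L" and M: "closed_subspace V M"
    and hs: "hilbert_schmidt V (\<lambda>x. orth_proj V L x - orth_proj V M x)"
    using assms by (auto simp: close_def)
  have "U (orth_proj V L (inv U y) - orth_proj V M (inv U y))
      = orth_proj W (U ` L) y - orth_proj W (U ` M) y" for y
    using unitary_orth_proj[OF V W U L, of "inv U y"] unitary_orth_proj[OF V W U M, of "inv U y"]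
    by (simp add: module_hom.diff[OF unitary_module_hom[OF U]] unitary_surj[OF U])
  then show ?thesis
    using hilbert_schmidt_conjugate[OF hs] unitary_closed_subspace[OF V W U] L M
    by (simp add: close_def)
qed

section \<open>Lagrangians under a grading-preserving unitary\<close>

context
  assumes gr: "\<And>x. U (grading V x) = grading W (U x)"
begin

lemma unitary_isotropic: "isotropic V L \<Longrightarrow> isotropic W (U ` L)"
  by (auto simp: isotropic_def unitary_subspace[OF U] gr[symmetric] unitary_iprod[OF U])

text \<open>Carries over both size conditions: finite codimension for sub-Lagrangians and equality
  with the whole space for Lagrangians.\<close>

lemma unitary_plus_grading: "U ` L + grading W ` U ` L = U ` (L + grading V ` L)"
proof
  show "U ` L + grading W ` U ` L \<subseteq> U ` (L + grading V ` L)"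
    by (auto simp: set_plus_def gr[symmetric] module_hom.add[OF unitary_module_hom[OF U], symmetric]
        intro!: imageI)
  show "U ` (L + grading V ` L) \<subseteq> U ` L + grading W ` U ` L"
    by (auto simp: module_hom.add[OF unitary_module_hom[OF U]] gr elim!: set_plus_elim intro!: set_plus_intro)
qed

lemma unitary_sub_lagrangian:
  assumes "sub_lagrangian V L"
  shows "sub_lagrangian W (U ` L)"
proof -
  obtain F where F: "finite F" "module.span (scale V) ((L + grading V ` L) \<union> F) = UNIV"
    using assms by (auto simp: sub_lagrangian_def)
  \<comment> \<open>The finite set \<open>F\<close> spanning the missing directions in
    \<open>V\<close> is moved along by \<open>U\<close>.\<close>
  have "module.span (scale W) ((U ` L + grading W ` U ` L) \<union> U ` F) = UNIV"
    using module_hom.span_image[OF unitary_module_hom[OF U], of "(L + grading V ` L) \<union> F"]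
      F(2) unitary_bij[OF U]
    by (simp add: unitary_plus_grading image_Un bij_is_surj)
  then show ?thesis
    using assms F(1) unitary_closed[OF V W U] unitary_isotropic
    unfolding sub_lagrangian_def by blast
qed

lemma unitary_lagrangian: "lagrangian V L \<Longrightarrow> lagrangian W (U ` L)"
  using unitary_bij[OF U] by (simp add: lagrangian_def unitary_isotropic unitary_plus_grading bij_is_surj)

end

end

section \<open>Polarizations\<close>

lemma polarized_hilbert_space: "polarized_super_hilbert_space V \<Longrightarrow> hilbert_space V"
  by (simp add: polarized_super_hilbert_space_def super_hilbert_space_def)

text \<open>The passage from some representative to all: the isomorphism supplies one
  \<open>L\<close> with a good image, \<open>M\<close> is close to \<open>L\<close>, and
  \<open>U\<close> preserves closeness.\<close>

lemma polarized_isomorphism_polarization: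
  assumes V: "polarized_super_hilbert_space V" and W: "polarized_super_hilbert_space W"
    and U: "polarized_isomorphism V W U" and M: "M \<in> polarization V"
  shows "U ` M \<in> polarization W"
proof -
  obtain K where K: "polarization V = {M. sub_lagrangian V M \<and> close V K M}"
    using V by (auto simp: polarized_super_hilbert_space_def)
  obtain K' where K': "polarization W = {M. sub_lagrangian W M \<and> close W K' M}"
    using W by (auto simp: polarized_super_hilbert_space_def)
  obtain L where L: "L \<in> polarization V" "U ` L \<in> polarization W"
    using U by (auto simp: polarized_isomorphism_def)
  have u: "unitary_map V W U" and gr: "\<And>x. U (grading V x) = grading W (U x)"
    using U by (auto simp: polarized_isomorphism_def)
  have "close V L M" using L(1) M K close_sym close_trans by blast
  then have "close W (U ` L) (U ` M)"
    by (rule unitary_close[OF polarized_hilbert_space[OF V] polarized_hilbert_space[OF W] u])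
  then have "close W K' (U ` M)" using L(2) K' close_trans by blast
  moreover have "sub_lagrangian W (U ` M)"
    using unitary_sub_lagrangian[OF polarized_hilbert_space[OF V] polarized_hilbert_space[OF W] u gr]
      M K by blast
  ultimately show ?thesis using K' by blast
qed

section \<open>Direct sums\<close>

text \<open>Only the grading changes under the shift, and \<open>hilbert_space\<close> does not
  mention it.\<close>

lemma hilbert_space_parity_shift: "hilbert_space V \<Longrightarrow> hilbert_space (parity_shift V)"
  unfolding hilbert_space_def parity_shift_def super_hilbert.simps .

text \<open>The norm of the product type is the Euclidean combination of the two norms, which is the
  norm induced by the sum of the inner products.\<close>

lemma hilbert_space_direct_sum:
  assumes V: "hilbert_space V" and W: "hilbert_space W"
  shows "hilbert_space (direct_sum V W)"
proof -
  have "vector_space (scale (direct_sum V W))"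
    using vector_space.vector_space_assms[OF vector_space_scale[OF V]]
      vector_space.vector_space_assms[OF vector_space_scale[OF W]]
    by (simp add: vector_space_def direct_sum_def split_beta prod_eq_iff)
  then show ?thesis
    unfolding hilbert_space_def[of "direct_sum V W"]
  proof (intro conjI allI)
    fix x y
    show "iprod (direct_sum V W) y x = conjugation (iprod (direct_sum V W) x y)"
      using iprod_commute[OF V, of "fst y" "fst x"] iprod_commute[OF W, of "snd y" "snd x"]
      by (simp add: direct_sum_def split_beta conjugation_add)
  qed (auto simp: direct_sum_def split_beta prod_eq_iff scale_of_real[OF V] scale_of_real[OF W]
      iprod_add_left[OF V] iprod_add_left[OF W] iprod_scale_left[OF V] iprod_scale_left[OF W]
      iprod_self[OF V] iprod_self[OF W] norm_prod_def algebra_simps)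
qed

lemma unitary_map_direct_sum:
  assumes "hilbert_space V" "hilbert_space W" "hilbert_space V'" "hilbert_space W'"
    and S: "unitary_map V V' S" and T: "unitary_map W W' T"
  shows "unitary_map (direct_sum V W) (direct_sum V' W') (map_prod S T)"
proof -
  have "vector_space (scale (direct_sum V W))" "vector_space (scale (direct_sum V' W'))"
    using assms by (auto intro!: vector_space_scale hilbert_space_direct_sum)
  moreover have "bij (map_prod S T)"
    using S T by (simp add: unitary_map_def bij_def prod.inj_map map_prod_surj)
  ultimately show ?thesis
    using S T by (auto simp: unitary_map_def Vector_Spaces.linear_iff direct_sum_def)
qed

lemma unitary_map_parity_shift:
  "unitary_map V W U \<Longrightarrow> unitary_map (parity_shift V) (parity_shift W) U"
  by (simp add: unitary_map_def parity_shift_def)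

text \<open>The graph of \<open>inv S\<close> is the converse of the graph of \<open>S\<close>, so
  the composition moves first coordinates of \<open>L\<close> by \<open>S\<close> and second ones by
  \<open>T\<close>.\<close>

lemma rel_compose_op_graph_inv:
  assumes "bij S"
  shows "op_graph T \<circ>\<^sub>R L \<circ>\<^sub>R op_graph (inv S) = map_prod S T ` L"
proof -
  have "x = S y" if "inv S x = y" for x y
    using that assms by (auto simp: bij_is_surj surj_f_inv_f)
  then show ?thesis
    using assms by (force simp: rel_compose_def op_graph_def relcomp_unfold bij_is_inj)
qed

theorem proposition3p7:
  fixes V0 :: "('k::real_or_complex, 'v0::banach) polarized"
    and V1 :: "('k, 'v1::banach) polarized"
    and W0 :: "('k, 'w0::banach) polarized"
    and W1 :: "('k, 'w1::banach) polarized"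
    and S :: "'v0 \<Rightarrow> 'w0" and T :: "'v1 \<Rightarrow> 'w1"
    and L :: "('v0 \<times> 'v1) set"
  assumes "polarized_super_hilbert_space V0" and "polarized_super_hilbert_space V1"
    and "polarized_super_hilbert_space W0" and "polarized_super_hilbert_space W1"
    and "split_lagrangian V0 V1 L"
    and "polarized_isomorphism V0 W0 S" and "polarized_isomorphism V1 W1 T"
  shows "split_lagrangian W0 W1 (op_graph T \<circ>\<^sub>R L \<circ>\<^sub>R op_graph (hilbert_adjoint V0 W0 S))"
proof -
  let ?V = "direct_sum (parity_shift V0) V1" and ?W = "direct_sum (parity_shift W0) W1"
  let ?U = "map_prod S T"
  note H = assms(1-4)[THEN polarized_hilbert_space]
  have S: "unitary_map V0 W0 S" and T: "unitary_map V1 W1 T"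
    and gr: "\<And>x. S (grading V0 x) = grading W0 (S x)" "\<And>x. T (grading V1 x) = grading W1 (T x)"
    using assms(6,7) by (auto simp: polarized_isomorphism_def)
  have HV: "hilbert_space ?V" and HW: "hilbert_space ?W"
    using H by (auto intro: hilbert_space_direct_sum hilbert_space_parity_shift)
  have U: "unitary_map ?V ?W ?U"
    using H S T by (intro unitary_map_direct_sum unitary_map_parity_shift hilbert_space_parity_shift)
  \<comment> \<open>The shifted grading carries a minus sign on the first summand, which
    \<open>S\<close> respects by linearity.\<close>
  have grU: "?U (grading ?V x) = grading ?W (?U x)" for x
    using gr module_hom.neg[OF unitary_module_hom[OF S]]
    by (cases x) (simp add: direct_sum_def parity_shift_def)
  obtain M N where M: "M \<in> polarization V0" and N: "N \<in> polarization V1"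
    and cl: "close ?V L (orth V0 M \<times> N)" and lag: "lagrangian ?V L"
    using assms(5) by (auto simp: split_lagrangian_def)
  \<comment> \<open>The model subspace of the source goes to a model subspace of the target, because
    a unitary commutes with orthogonal complements.\<close>
  have "?U ` (orth V0 M \<times> N) = orth W0 (S ` M) \<times> T ` N"
    by (simp add: unitary_orth[OF S] map_prod_surj_on)
  then have "close ?W (?U ` L) (orth W0 (S ` M) \<times> T ` N)"
    using unitary_close[OF HV HW U cl] by simp
  moreover have "S ` M \<in> polarization W0" "T ` N \<in> polarization W1"
    using polarized_isomorphism_polarization assms M N by blast+
  moreover have "lagrangian ?W (?U ` L)"
    using unitary_lagrangian[OF HV HW U grU lag] .
  ultimately have "split_lagrangian W0 W1 (?U ` L)"
    by (auto simp: split_lagrangian_def)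
  then show ?thesis
    by (simp add: hilbert_adjoint_unitary[OF H(1,3) S] rel_compose_op_graph_inv[OF unitary_bij[OF S]])
qed

end
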